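(* $\mathrm{MFA}^\cup$ does not cover $\mathrm{RCA}_1$: there exists a Horn-$\mathcal{SRIQ}$ TBox $\mathcal{T}$ that is $\mathrm{RCA}_1$ but not $\mathrm{MFA}^\cup$.
   Context: Terms are built from constants (individuals) and function symbols. A term $t'$ is a subterm of $t$ if $t'=t$, or $t=f(s_1,\dots,s_k)$ and $t'$ is a subterm of some $s_i$; it is a proper subterm if moreover $t'\ne t$. A term $t$ is $n$-cyclic iff there are terms $f(\vec s_1),\dots,f(\vec s_{n+1})$ (same function symbol $f$) such that $f(\vec s_{n+1})$ is a subterm of $t$ and $f(\vec s_i)$ is a proper subterm of $f(\vec s_{i+1})$ for $i=1,\dots,n$; $1$-cyclic terms are called cyclic. A fact is a ground atom. A Horn-$\mathcal{SRIQ}$ TBox is a finite set of axioms of the forms $A_1\sqcap\dots\sqcap A_n\sqsubseteq B$, $A\sqsubseteq\forall R.B$, $A\sqsubseteq\,\leq 1 R.B$, $A\sqsubseteq\exists R.B$ (existential axioms), $S\sqsubseteq R$, $S^-\sqsubseteq R$, $S\circ V\sqsubseteq R$, where $A_i,A,B$ are concept names ($\top,\bot$ among them) and $R,S,V$ role names, satisfying the usual Horn-$\mathcal{SRIQ}$ global restrictions. Each axiom is translated into a rule: $A_1\sqcap\dots\sqcap A_n\sqsubseteq B\mapsto A_1(x)\wedge\dots\wedge A_n(x)\to B(x)$; $A\sqsubseteq\forall R.B\mapsto A(x)\wedge R(x,y)\to B(y)$; $A\sqsubseteq\,\leq1R.B\mapsto A(x)\wedge R(x,y)\wedge B(y)\wedge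 R(x,z)\wedge B(z)\to y\approx z$; $A\sqsubseteq\exists R.B\mapsto A(x)\to\exists y[R(x,y)\wedge B(y)]$; $S\sqsubseteq R\mapsto S(x,y)\to R(x,y)$; $S^-\sqsubseteq R\mapsto S(y,x)\to R(x,y)$; $S\circ V\sqsubseteq R\mapsto S(x,y)\wedge V(y,z)\to R(x,z)$. $\mathcal{R}_\mathcal{T}$ is the set of translations of the axioms of $\mathcal{T}$ together with, for every predicate $p$ of arity $k$ occurring, the rule $p(x_1,\dots,x_k)\to\top(x_1)\wedge\dots\wedge\top(x_k)$. Rules of the form $\beta(\vec x,\vec z)\to\exists\vec y\,\eta(\vec x,\vec y)$ are TGDs, rules $\beta(\vec x)\to x\approx y$ are EGDs. For a rule set $\mathcal{R}$: $\mathcal{R}^\exists$ = TGDs with existentially quantified variables, $\mathcal{R}^\forall$ = TGDs without, $\mathcal{R}^\approx$ = EGDs. A program is a pair $\langle\mathcal{R},\mathcal{I}\rangle$ with $\mathcal{I}$ a finite set of equality-free facts. Skolemization: for a TGD $\rho=\beta(\vec x,\vec z)\to\exists\vec y\,\eta(\vec x,\vec y)$, $sk(\rho)$ is $\beta\to\eta\sigma_{sk}$ where $\sigma_{sk}$ maps each $y\in\vec y$ to $f^y_\rho(\vec x)$ with $f^y_\rho$ a fresh function symbol unique to $y$ and $\rho$. Restricted application: for a TGD $\rho$ and a set of facts $F$, $\rho_R(F)$ is the set of facts $\varphi$ such that there is a substitution $\sigma$ with $\beta\sigma\subseteq F$, $\varphi\in sk(\eta)\sigma$, and there is no substitution $\tau\supseteq\sigma$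 with $\eta\tau\subseteq F$; for a set of TGDs, $\mathcal{R}_R(F)=F\cup\bigcup_{\rho\in\mathcal{R}}\rho_R(F)$. The depth of a term is $0$ for constants and $1+\max_i dep(t_i)$ for $f(t_1,\dots,t_k)$. Fix a total strict order $\prec$ on terms with $t\prec u$ only if $dep(t)\le dep(u)$ ("$t$ is greater than $u$"). For a set of EGDs $\mathcal{R}$ and facts $F$, let $\mapsto$ be the minimal congruence relation on terms containing $(\sigma(x),\sigma(y))$ for every EGD $\beta(\vec x)\to x\approx y\in\mathcal{R}$ and substitution $\sigma$ with $\beta\sigma\subseteq F$; $\mathcal{R}(F)$ is obtained from $F$ by replacing every term $t$ by the $\prec$-greatest $u$ with $t\mapsto u$. The restricted chase sequence of $\langle\mathcal{R},\mathcal{I}\rangle$: $F_1=\mathcal{I}$, and for $i\ge2$, $F_i=\mathcal{R}^\approx(F_{i-1})$ if this differs from $F_{i-1}$; otherwise $F_i=(\mathcal{R}^\forall)_R(F_{i-1})$ if this differs from $F_{i-1}$; otherwise $F_i=(\mathcal{R}^\exists)_R(F_{i-1})$. The restricted chase is $\mathrm{rChase}=\bigcup_i F_i$. Restricted terms: for a term $t$: if $t=f^y_\rho(s)$ where $\rho=A(x)\to\exists y[R(x,y)\wedge B(y)]\in\mathcal{R}_\mathcal{T}$, let $\mathcal{I}(t)=\{A(s),R(s,t),B(t)\}\cup\mathcal{I}(s)$; otherwise $\mathcal{I}(t)=\emptyset$. Let $RT(\mathcal{T},t)=\langle\mathcal{R}_\mathcal{T}^\forall\cup\mathcal{R}_\mathcal{T}^\approx,\mathcal{I}(t)\rangle$.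 A term $t=f^y_\rho(s)$ with $\rho=A(x)\to\exists y[R(x,y)\wedge B(y)]$ is restricted with respect to $\mathcal{T}$ iff there is a term $u$ with $\{R([s],u),B(u)\}\subseteq\mathrm{rChase}(RT(\mathcal{T},s))$, where $[s]=v$ if $s$ is replaced by $v$ during the computation of the restricted chase sequence, and $[s]=s$ otherwise. The set $\mathcal{V}_\mathcal{T}$: let $\star$ be a special constant, $Eq$ a fresh binary predicate, and let the critical instance $\mathcal{I}^\star$ be the set of all facts $p(\star,\dots,\star)$ for predicates $p$ occurring in TGDs of $\mathcal{R}_\mathcal{T}$. $\mathcal{V}_\mathcal{T}$ is the set obtained from $\mathcal{I}^\star$ by repeatedly applying the following expansion rules (in any order) until none applies: ($\forall$-rule) for a TGD $\rho\in\mathcal{R}_\mathcal{T}^\forall$, add $\rho_R(\mathcal{V}_\mathcal{T})$; ($\exists$-rule) for $\rho=A(x)\to\exists y[R(x,y)\wedge B(y)]\in\mathcal{R}_\mathcal{T}$ and a term $t$ with $A(t)\in\mathcal{V}_\mathcal{T}$ such that $f^y_\rho(t)$ is not restricted with respect to $\mathcal{T}$, add $R(t,f^y_\rho(t))$ and $B(f^y_\rho(t))$; ($\approx$-rule) for an EGD $\beta\to x\approx y\in\mathcal{R}_\mathcal{T}$ and substitution $\sigma$ with $\beta\sigma\subseteq\mathcal{V}_\mathcal{T}$, add $Eq(\sigma(x),\sigma(y))$ and $Eq(\sigma(y),\sigma(x))$; ($Eq$-rule) if $Eq(t,u)\in\mathcal{V}_\mathcal{T}$ and $p(u_1,\dots,u_k)\in\mathcal{V}_\mathcal{T}$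 with $p\ne Eq$, $dep(t)\le dep(u)$ and $u=u_j$ for some $j$, add the fact obtained from $p(u_1,\dots,u_k)$ by replacing $u$ with $t$. A TBox $\mathcal{T}$ is $\mathrm{RCA}_n$ iff no $n$-cyclic term occurs in $\mathcal{V}_\mathcal{T}$. $\mathrm{MFA}^\cup$: Let $\Sigma_\mathcal{T}$ be the set of TGDs obtained from $\mathcal{R}_\mathcal{T}$ by replacing every EGD $\beta\to x\approx y$ by the TGD $\beta\to Eq(x,y)$. Let $\mathsf{Eq}=\{\top(x)\to Eq(x,x),\ Eq(x,y)\to Eq(y,x),\ Eq(x,z)\wedge Eq(z,y)\to Eq(x,y)\}$. A singularization of a rule $\rho$ is obtained by doing, for every variable $v$ in the body: rename its occurrences in the body by distinct fresh variables $v_1,\dots,v_m$, pick some $j\in\{1,\dots,m\}$, add $Eq(v_1,v_j),\dots,Eq(v_m,v_j)$ to the body, and replace every occurrence of $v$ in the head by $v_j$. $\mathrm{Sing}(\Sigma)$ is the set of all sets $\Sigma'$ consisting of $\mathsf{Eq}$ plus exactly one singularization of each rule of $\Sigma$. A set of TGDs $\Sigma$ is MFA iff the least set of facts containing the critical instance of $\Sigma$ (all facts $p(\star,\dots,\star)$ for predicates $p$ in $\Sigma$) and closed under the skolemized rules $sk(\rho)$, $\rho\in\Sigma$ (the oblivious chase) contains no cyclic term. $\mathcal{T}$ is $\mathrm{MFA}^\cup$ iff $\bigcup_{\Sigma'\in\mathrm{Sing}(\Sigma_\mathcal{T})}\Sigma'$ is MFA. *)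

theory Defs
  imports Main
begin

text \<open>The special constant of critical instances is kept apart from the individuals.\<close>

datatype const = Star | Ind nat

datatype 'f trm = Con const | Fn 'f "'f trm list"

datatype cname = TopC | BotC | CName nat

datatype rname = RName nat

datatype pred = Concept cname | Role rname | EqP

datatype 'a atom = Atom (atom_pred: pred) (atom_args: "'a list")

text \<open>
  Bodies and heads are conjunctions, given as lists. The existentially quantified variables of a
  TGD are the variables of its head that do not occur in its body.
\<close>

datatype 'v rule =
    TGD "'v atom list" "'v atom list"
  | EGD "'v atom list" 'v 'v

text \<open>The function symbol \<open>f\<^sup>y\<^sub>\<rho>\<close> is the pair \<open>(\<rho>, y)\<close>.\<close>

type_synonym 'v fsym = "'v rule \<times> 'v"
type_synonym 'v sterm = "'v fsym trm"
type_synonym 'v fact = "'v sterm atom"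

primrec depth :: "'f trm \<Rightarrow> nat" where
  "depth (Con c) = 0"
| "depth (Fn f ts) = Suc (foldr max (map depth ts) 0)"

inductive subterm :: "'f trm \<Rightarrow> 'f trm \<Rightarrow> bool" where
  subterm_refl: "subterm t t"
| subterm_arg: "s \<in> set ss \<Longrightarrow> subterm t s \<Longrightarrow> subterm t (Fn f ss)"

definition proper_subterm :: "'f trm \<Rightarrow> 'f trm \<Rightarrow> bool" where
  "proper_subterm t u \<longleftrightarrow> subterm t u \<and> t \<noteq> u"

definition cyclic :: "nat \<Rightarrow> 'f trm \<Rightarrow> bool" where
  "cyclic n t \<longleftrightarrow> (\<exists>f ss. subterm (Fn f (ss (n + 1))) t \<and>
     (\<forall>i\<in>{1..n}. proper_subterm (Fn f (ss i)) (Fn f (ss (i + 1)))))"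

definition terms_of :: "'f trm atom set \<Rightarrow> 'f trm set" where
  "terms_of F = (\<Union>a\<in>F. set (atom_args a))"

definition atoms_vars :: "'v atom list \<Rightarrow> 'v list" where
  "atoms_vars as = concat (map atom_args as)"

fun rule_atoms :: "'v rule \<Rightarrow> 'v atom set" where
  "rule_atoms (TGD b h) = set b \<union> set h"
| "rule_atoms (EGD b x y) = set b"

fun existential :: "'v rule \<Rightarrow> bool" where
  "existential (TGD b h) \<longleftrightarrow> \<not> set (atoms_vars h) \<subseteq> set (atoms_vars b)"
| "existential (EGD b x y) \<longleftrightarrow> False"

definition tgds :: "'v rule set \<Rightarrow> 'v rule set" where
  "tgds \<R> = {\<rho>\<in>\<R>. \<exists>b h. \<rho> = TGD b h}"

definition ex_tgds :: "'v rule set \<Rightarrow> 'v rule set" where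
  "ex_tgds \<R> = {\<rho>\<in>tgds \<R>. existential \<rho>}"

definition univ_tgds :: "'v rule set \<Rightarrow> 'v rule set" where
  "univ_tgds \<R> = {\<rho>\<in>tgds \<R>. \<not> existential \<rho>}"

definition egds :: "'v rule set \<Rightarrow> 'v rule set" where
  "egds \<R> = {\<rho>\<in>\<R>. \<exists>b x y. \<rho> = EGD b x y}"

definition critical_instance :: "'v rule set \<Rightarrow> 'v fact set" where
  "critical_instance \<R> = (\<Union>\<rho>\<in>\<R>. map_atom (\<lambda>_. Con Star) ` rule_atoms \<rho>)"

definition inst :: "('v \<Rightarrow> 'v sterm) \<Rightarrow> 'v atom list \<Rightarrow> 'v fact set" where
  "inst \<sigma> as = map_atom \<sigma> ` set as"

definition frontier :: "'v atom list \<Rightarrow> 'v atom list \<Rightarrow> 'v list" where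
  "frontier b h = remdups (filter (\<lambda>v. v \<in> set (atoms_vars h)) (atoms_vars b))"

text \<open>The composition of \<open>\<sigma>\<^sub>s\<^sub>k\<close>, followed by \<open>\<sigma>\<close>, for the TGD with body \<open>b\<close> and head \<open>h\<close>.\<close>

definition skolem_subst ::
  "'v atom list \<Rightarrow> 'v atom list \<Rightarrow> ('v \<Rightarrow> 'v sterm) \<Rightarrow> 'v \<Rightarrow> 'v sterm" where
  "skolem_subst b h \<sigma> v =
     (if v \<in> set (atoms_vars b) then \<sigma> v else Fn (TGD b h, v) (map \<sigma> (frontier b h)))"

text \<open>
  Substitutions are total functions here; only their values on the body variables matter, so
  \<open>\<tau> \<supseteq> \<sigma>\<close> means agreement on the body variables.
\<close>

fun restricted_app :: "'v rule \<Rightarrow> 'v fact set \<Rightarrow> 'v fact set" where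
  "restricted_app (TGD b h) F =
     {\<phi>. \<exists>\<sigma>. inst \<sigma> b \<subseteq> F \<and> \<phi> \<in> inst (skolem_subst b h \<sigma>) h \<and>
         \<not> (\<exists>\<tau>. (\<forall>v\<in>set (atoms_vars b). \<tau> v = \<sigma> v) \<and> inst \<tau> h \<subseteq> F)}"
| "restricted_app (EGD b x y) F = {}"

definition restricted_apps :: "'v rule set \<Rightarrow> 'v fact set \<Rightarrow> 'v fact set" where
  "restricted_apps \<R> F = F \<union> (\<Union>\<rho>\<in>\<R>. restricted_app \<rho> F)"

text \<open>\<open>prec t u\<close> reads ``\<open>t\<close> is greater than \<open>u\<close>''; thus greater terms are not deeper.\<close>

definition term_order :: "('f trm \<Rightarrow> 'f trm \<Rightarrow> bool) \<Rightarrow> bool" where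
  "term_order prec \<longleftrightarrow> irreflp prec \<and> transp prec \<and> totalp prec \<and>
     (\<forall>t u. prec t u \<longrightarrow> depth t \<le> depth u)"

inductive egd_cong :: "'v rule set \<Rightarrow> 'v fact set \<Rightarrow> 'v sterm \<Rightarrow> 'v sterm \<Rightarrow> bool"
  for \<R> F where
  "EGD b x y \<in> \<R> \<Longrightarrow> inst \<sigma> b \<subseteq> F \<Longrightarrow> egd_cong \<R> F (\<sigma> x) (\<sigma> y)"
| "egd_cong \<R> F t t"
| "egd_cong \<R> F t u \<Longrightarrow> egd_cong \<R> F u t"
| "egd_cong \<R> F t u \<Longrightarrow> egd_cong \<R> F u v \<Longrightarrow> egd_cong \<R> F t v"
| "list_all2 (egd_cong \<R> F) ts us \<Longrightarrow> egd_cong \<R> F (Fn f ts) (Fn f us)"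

text \<open>
  The greatest term of the class of \<open>t\<close>. It exists whenever the relevant set of facts and set of
  rules are finite, since then a class has finitely many members of any given depth.
\<close>

definition representative ::
  "('v sterm \<Rightarrow> 'v sterm \<Rightarrow> bool) \<Rightarrow> 'v rule set \<Rightarrow> 'v fact set \<Rightarrow> 'v sterm \<Rightarrow> 'v sterm" where
  "representative prec \<R> F t =
     (THE u. egd_cong \<R> F t u \<and> (\<forall>v. egd_cong \<R> F t v \<and> v \<noteq> u \<longrightarrow> prec u v))"

definition egd_app ::
  "('v sterm \<Rightarrow> 'v sterm \<Rightarrow> bool) \<Rightarrow> 'v rule set \<Rightarrow> 'v fact set \<Rightarrow> 'v fact set" where
  "egd_app prec \<R> F = map_atom (representative prec \<R> F) ` F"

definition chase_step ::
  "('v sterm \<Rightarrow> 'v sterm \<Rightarrow> bool) \<Rightarrow> 'v rule set \<Rightarrow> 'v fact set \<Rightarrow> 'v fact set" where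
  "chase_step prec \<R> F =
     (if egd_app prec (egds \<R>) F \<noteq> F then egd_app prec (egds \<R>) F
      else if restricted_apps (univ_tgds \<R>) F \<noteq> F then restricted_apps (univ_tgds \<R>) F
      else restricted_apps (ex_tgds \<R>) F)"

primrec chase_seq ::
  "('v sterm \<Rightarrow> 'v sterm \<Rightarrow> bool) \<Rightarrow> 'v rule set \<Rightarrow> 'v fact set \<Rightarrow> nat \<Rightarrow> 'v fact set" where
  "chase_seq prec \<R> I 0 = I"
| "chase_seq prec \<R> I (Suc i) = chase_step prec \<R> (chase_seq prec \<R> I i)"

definition rchase ::
  "('v sterm \<Rightarrow> 'v sterm \<Rightarrow> bool) \<Rightarrow> 'v rule set \<Rightarrow> 'v fact set \<Rightarrow> 'v fact set" where
  "rchase prec \<R> I = (\<Union>i. chase_seq prec \<R> I i)"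

text \<open>
  A term may be replaced repeatedly along the chase sequence: \<open>replaced_seq\<close> follows these
  replacements, and \<open>replaced_by\<close> is the term that results in the end.
\<close>

primrec replaced_seq ::
  "('v sterm \<Rightarrow> 'v sterm \<Rightarrow> bool) \<Rightarrow> 'v rule set \<Rightarrow> 'v fact set \<Rightarrow> 'v sterm \<Rightarrow> nat \<Rightarrow> 'v sterm"
  where
  "replaced_seq prec \<R> I t 0 = t"
| "replaced_seq prec \<R> I t (Suc i) =
     (let F = chase_seq prec \<R> I i in
      if egd_app prec (egds \<R>) F \<noteq> F
      then representative prec (egds \<R>) F (replaced_seq prec \<R> I t i)
      else replaced_seq prec \<R> I t i)"

definition replaced_by ::
  "('v sterm \<Rightarrow> 'v sterm \<Rightarrow> bool) \<Rightarrow> 'v rule set \<Rightarrow> 'v fact set \<Rightarrow> 'v sterm \<Rightarrow> 'v sterm" where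
  "replaced_by prec \<R> I t = (THE v. \<exists>i. \<forall>j\<ge>i. replaced_seq prec \<R> I t j = v)"

datatype axiom =
    SubConj "cname list" cname
  | SubAll cname rname cname
  | SubAtMostOne cname rname cname
  | SubEx cname rname cname
  | SubRole rname rname
  | SubInvRole rname rname
  | SubComp rname rname rname

datatype role = RN rname | Inv rname

fun inv_role :: "role \<Rightarrow> role" where
  "inv_role (RN R) = Inv R"
| "inv_role (Inv R) = RN R"

fun role_inclusions :: "axiom \<Rightarrow> (role list \<times> rname) set" where
  "role_inclusions (SubRole S R) = {([RN S], R)}"
| "role_inclusions (SubInvRole S R) = {([Inv S], R)}"
| "role_inclusions (SubComp S V R) = {([RN S, RN V], R)}"
| "role_inclusions _ = {}"

definition regular_role_order :: "(role \<Rightarrow> role \<Rightarrow> bool) \<Rightarrow> bool" where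
  "regular_role_order ord \<longleftrightarrow> irreflp ord \<and> transp ord \<and>
     (\<forall>S R. ord S R \<longleftrightarrow> ord (inv_role S) R)"

definition regular_inclusion :: "(role \<Rightarrow> role \<Rightarrow> bool) \<Rightarrow> role list \<Rightarrow> rname \<Rightarrow> bool" where
  "regular_inclusion ord w R \<longleftrightarrow>
     w = [RN R, RN R] \<or> w = [Inv R] \<or>
     (\<exists>v. v \<noteq> [] \<and> (\<forall>S\<in>set v. ord S (RN R)) \<and> (w = v \<or> w = RN R # v \<or> w = v @ [RN R]))"

definition regular :: "axiom set \<Rightarrow> bool" where
  "regular T \<longleftrightarrow> (\<exists>ord. regular_role_order ord \<and>
     (\<forall>ax\<in>T. \<forall>(w, R)\<in>role_inclusions ax. regular_inclusion ord w R))"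

inductive nonsimple :: "axiom set \<Rightarrow> rname \<Rightarrow> bool" for T where
  "SubComp S V R \<in> T \<Longrightarrow> nonsimple T R"
| "SubRole S R \<in> T \<Longrightarrow> nonsimple T S \<Longrightarrow> nonsimple T R"
| "SubInvRole S R \<in> T \<Longrightarrow> nonsimple T S \<Longrightarrow> nonsimple T R"

definition horn_sriq_tbox :: "axiom set \<Rightarrow> bool" where
  "horn_sriq_tbox T \<longleftrightarrow> finite T \<and> (\<forall>As B. SubConj As B \<in> T \<longrightarrow> As \<noteq> []) \<and>
     regular T \<and> (\<forall>A R B. SubAtMostOne A R B \<in> T \<longrightarrow> \<not> nonsimple T R)"

datatype var = VX | VY | VZ

abbreviation cat :: "cname \<Rightarrow> 'a \<Rightarrow> 'a atom" where
  "cat A t \<equiv> Atom (Concept A) [t]"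

abbreviation rat :: "rname \<Rightarrow> 'a \<Rightarrow> 'a \<Rightarrow> 'a atom" where
  "rat R t u \<equiv> Atom (Role R) [t, u]"

abbreviation eqat :: "'a \<Rightarrow> 'a \<Rightarrow> 'a atom" where
  "eqat t u \<equiv> Atom EqP [t, u]"

definition ex_rule :: "cname \<Rightarrow> rname \<Rightarrow> cname \<Rightarrow> var rule" where
  "ex_rule A R B = TGD [cat A VX] [rat R VX VY, cat B VY]"

fun rule_of :: "axiom \<Rightarrow> var rule" where
  "rule_of (SubConj As B) = TGD (map (\<lambda>A. cat A VX) As) [cat B VX]"
| "rule_of (SubAll A R B) = TGD [cat A VX, rat R VX VY] [cat B VY]"
| "rule_of (SubAtMostOne A R B) =
     EGD [cat A VX, rat R VX VY, cat B VY, rat R VX VZ, cat B VZ] VY VZ"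
| "rule_of (SubEx A R B) = ex_rule A R B"
| "rule_of (SubRole S R) = TGD [rat S VX VY] [rat R VX VY]"
| "rule_of (SubInvRole S R) = TGD [rat S VY VX] [rat R VX VY]"
| "rule_of (SubComp S V R) = TGD [rat S VX VY, rat V VY VZ] [rat R VX VZ]"

definition preds_of :: "'v rule set \<Rightarrow> pred set" where
  "preds_of \<R> = (\<Union>\<rho>\<in>\<R>. atom_pred ` rule_atoms \<rho>)"

definition top_rules :: "pred set \<Rightarrow> var rule set" where
  "top_rules P =
     {TGD [cat A VX] [cat TopC VX] | A. Concept A \<in> P} \<union>
     {TGD [rat R VX VY] [cat TopC VX, cat TopC VY] | R. Role R \<in> P}"

definition rules_of :: "axiom set \<Rightarrow> var rule set" where
  "rules_of T = rule_of ` T \<union> top_rules (preds_of (rule_of ` T))"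

definition ex_term :: "cname \<Rightarrow> rname \<Rightarrow> cname \<Rightarrow> var sterm \<Rightarrow> var sterm" where
  "ex_term A R B s = Fn (ex_rule A R B, VY) [s]"

text \<open>The union below has at most one member, as \<open>ex_rule\<close> is injective.\<close>

fun term_instance :: "axiom set \<Rightarrow> var sterm \<Rightarrow> var fact set" where
  "term_instance T (Fn f [s]) =
     \<Union>{{cat A s, rat R s (Fn f [s]), cat B (Fn f [s])} \<union> term_instance T s | A R B.
          ex_rule A R B \<in> rules_of T \<and> f = (ex_rule A R B, VY)}"
| "term_instance T _ = {}"

definition restricted_term ::
  "(var sterm \<Rightarrow> var sterm \<Rightarrow> bool) \<Rightarrow> axiom set \<Rightarrow> var sterm \<Rightarrow> bool" where
  "restricted_term prec T t \<longleftrightarrow>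
     (\<exists>A R B s u. ex_rule A R B \<in> rules_of T \<and> t = ex_term A R B s \<and>
        (let \<R> = univ_tgds (rules_of T) \<union> egds (rules_of T); I = term_instance T s in
         {rat R (replaced_by prec \<R> I s) u, cat B u} \<subseteq> rchase prec \<R> I))"

text \<open>
  No expansion rule applies to \<open>V\<close>. Replacement in the last condition is replacement of the
  arguments that are equal to \<open>u\<close>.
\<close>

definition expansion_closed ::
  "(var sterm \<Rightarrow> var sterm \<Rightarrow> bool) \<Rightarrow> axiom set \<Rightarrow> var fact set \<Rightarrow> bool" where
  "expansion_closed prec T V \<longleftrightarrow>
     (\<forall>\<rho>\<in>univ_tgds (rules_of T). restricted_app \<rho> V \<subseteq> V) \<and>
     (\<forall>A R B t. ex_rule A R B \<in> rules_of T \<and> cat A t \<in> V \<and>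
        \<not> restricted_term prec T (ex_term A R B t) \<longrightarrow>
        {rat R t (ex_term A R B t), cat B (ex_term A R B t)} \<subseteq> V) \<and>
     (\<forall>b x y \<sigma>. EGD b x y \<in> rules_of T \<and> inst \<sigma> b \<subseteq> V \<longrightarrow>
        {eqat (\<sigma> x) (\<sigma> y), eqat (\<sigma> y) (\<sigma> x)} \<subseteq> V) \<and>
     (\<forall>t u p us. eqat t u \<in> V \<and> Atom p us \<in> V \<and> p \<noteq> EqP \<and> depth t \<le> depth u \<and> u \<in> set us \<longrightarrow>
        Atom p (map (\<lambda>w. if w = u then t else w) us) \<in> V)"

text \<open>
  For a TGD without existential variables, being closed under restricted application amounts to
  being closed under ordinary application. Hence closed sets are stable under intersection, and
  exhaustive expansion of the critical instance yields the least closed set above it.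
\<close>

definition expansion_set ::
  "(var sterm \<Rightarrow> var sterm \<Rightarrow> bool) \<Rightarrow> axiom set \<Rightarrow> var fact set" where
  "expansion_set prec T =
     \<Inter>{V. critical_instance (tgds (rules_of T)) \<subseteq> V \<and> expansion_closed prec T V}"

definition RCA :: "(var sterm \<Rightarrow> var sterm \<Rightarrow> bool) \<Rightarrow> nat \<Rightarrow> axiom set \<Rightarrow> bool" where
  "RCA prec n T \<longleftrightarrow> (\<forall>t\<in>terms_of (expansion_set prec T). \<not> cyclic n t)"

inductive_set oblivious_chase :: "'v rule set \<Rightarrow> 'v fact set" for \<Sigma> where
  "\<phi> \<in> critical_instance \<Sigma> \<Longrightarrow> \<phi> \<in> oblivious_chase \<Sigma>"
| "TGD b h \<in> \<Sigma> \<Longrightarrow> (\<And>a. a \<in> inst \<sigma> b \<Longrightarrow> a \<in> oblivious_chase \<Sigma>) \<Longrightarrow>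
   \<phi> \<in> inst (skolem_subst b h \<sigma>) h \<Longrightarrow> \<phi> \<in> oblivious_chase \<Sigma>"

definition MFA :: "'v rule set \<Rightarrow> bool" where
  "MFA \<Sigma> \<longleftrightarrow> (\<forall>t\<in>terms_of (oblivious_chase \<Sigma>). \<not> cyclic 1 t)"

fun egd_to_tgd :: "'v rule \<Rightarrow> 'v rule" where
  "egd_to_tgd (TGD b h) = TGD b h"
| "egd_to_tgd (EGD b x y) = TGD b [eqat x y]"

definition sigma_of :: "axiom set \<Rightarrow> var rule set" where
  "sigma_of T = egd_to_tgd ` rules_of T"

text \<open>
  In a singularization, the \<open>i\<close>-th body occurrence (\<open>i \<ge> 1\<close>) of a variable \<open>v\<close> is renamed to
  \<open>(v, i)\<close>. Existential variables \<open>y\<close> become \<open>(y, 0)\<close>. The first argument of \<open>number_vars\<close> and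
  \<open>number_atoms\<close> collects the occurrences seen so far.
\<close>

fun number_vars :: "'v list \<Rightarrow> 'v list \<Rightarrow> ('v \<times> nat) list" where
  "number_vars seen [] = []"
| "number_vars seen (v # vs) = (v, Suc (count_list seen v)) # number_vars (v # seen) vs"

fun number_atoms :: "'v list \<Rightarrow> 'v atom list \<Rightarrow> ('v \<times> nat) atom list" where
  "number_atoms seen [] = []"
| "number_atoms seen (Atom p vs # as) =
     Atom p (number_vars seen vs) # number_atoms (vs @ seen) as"

definition singularize ::
  "('v \<Rightarrow> nat) \<Rightarrow> 'v atom list \<Rightarrow> 'v atom list \<Rightarrow> ('v \<times> nat) rule" where
  "singularize j b h =
     TGD (number_atoms [] b @
          concat (map (\<lambda>v. map (\<lambda>i. eqat (v, i) (v, j v)) [1..<count_list (atoms_vars b) v + 1])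
                      (remdups (atoms_vars b))))
         (map (map_atom (\<lambda>v. if v \<in> set (atoms_vars b) then (v, j v) else (v, 0))) h)"

fun singularizations :: "'v rule \<Rightarrow> ('v \<times> nat) rule set" where
  "singularizations (TGD b h) =
     {singularize j b h | j. \<forall>v\<in>set (atoms_vars b). j v \<in> {1..count_list (atoms_vars b) v}}"
| "singularizations (EGD b x y) = {}"

definition eq_rules :: "(var \<times> nat) rule set" where
  "eq_rules = (let x = (VX, 0); y = (VY, 0); z = (VZ, 0) in
     {TGD [cat TopC x] [eqat x x],
      TGD [eqat x y] [eqat y x],
      TGD [eqat x z, eqat z y] [eqat x y]})"

definition Sing :: "var rule set \<Rightarrow> (var \<times> nat) rule set set" where
  "Sing \<Sigma> = {eq_rules \<union> g ` \<Sigma> | g. \<forall>\<rho>\<in>\<Sigma>. g \<rho> \<in> singularizations \<rho>}"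

definition MFA_union :: "axiom set \<Rightarrow> bool" where
  "MFA_union T \<longleftrightarrow> MFA (\<Union>(Sing (sigma_of T)))"

end

theory Submission
  imports Defs
begin

text \<open>
  The witness is \<open>{\<top> \<sqsubseteq> \<exists>R.\<top>, R\<^sup>- \<sqsubseteq> R}\<close>. The oblivious chase builds \<open>f(\<star>)\<close>, \<open>f(f(\<star>))\<close>, and so on.
  On the other hand, \<open>f(f(\<star>))\<close> is restricted: symmetry of \<open>R\<close> turns \<open>R(\<star>, f(\<star>))\<close> into
  \<open>R(f(\<star>), \<star>)\<close>, so \<open>f(\<star>)\<close> already has an \<open>R\<close>-successor. Hence the expansion stops at \<open>f(\<star>)\<close>.
\<close>

text \<open>The witness has no \<open>SubAtMostOne\<close> axiom, so the chases inspected below run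
  without EGDs. The congruence is then equality, and no term is ever replaced.\<close>

lemma egd_cong_empty: "egd_cong {} F t u \<longleftrightarrow> t = u"
proof
  show "t = u" if "egd_cong {} F t u"
    using that
  proof (induction rule: egd_cong.induct)
    case (5 ts us f)
    then have "list_all2 (=) ts us"
      by (auto elim: list_all2_mono)
    then show ?case
      by (simp add: list.rel_eq)
  qed auto
qed (auto intro: egd_cong.intros)

lemma representative_empty: "representative prec {} F t = t"
  unfolding representative_def egd_cong_empty by auto

lemma egd_app_empty: "egd_app prec {} F = F"
  by (simp add: egd_app_def representative_empty[abs_def] atom.map_ident)

lemma replaced_by_no_egds:
  assumes "egds \<R> = {}"
  shows "replaced_by prec \<R> I t = t"
proof -
  have "replaced_seq prec \<R> I t i = t" for i
    by (induction i) (simp_all add: assms egd_app_empty)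
  then show ?thesis
    unfolding replaced_by_def by auto
qed

lemma restricted_app_univ_subset_rchase:
  assumes "egds \<R> = {}" and "\<rho> \<in> univ_tgds \<R>"
  shows "restricted_app \<rho> I \<subseteq> rchase prec \<R> I"
proof -
  have "restricted_app \<rho> I \<subseteq> restricted_apps (univ_tgds \<R>) I"
    using assms(2) by (auto simp: restricted_apps_def)
  \<comment> \<open>If the universal TGDs add nothing, the first step fires the existential ones
    instead; the left-hand side is then \<open>I\<close> itself, hence the union with stage
    0.\<close>
  also have "\<dots> \<subseteq> chase_seq prec \<R> I 0 \<union> chase_seq prec \<R> I 1"
    by (auto simp: chase_step_def assms(1) egd_app_empty)
  also have "\<dots> \<subseteq> rchase prec \<R> I"
    unfolding rchase_def by blast
  finally show ?thesis .
qed

lemma subterm_Con: "subterm t (Con c) \<longleftrightarrow> t = Con c"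
  by (auto elim: subterm.cases intro: subterm.intros)

lemma subterm_Fn: "subterm t (Fn f ss) \<longleftrightarrow> t = Fn f ss \<or> (\<exists>s\<in>set ss. subterm t s)"
  by (auto elim: subterm.cases intro: subterm.intros)

lemma cyclic_1: "cyclic 1 t \<longleftrightarrow>
    (\<exists>f ss ts. subterm (Fn f ts) t \<and> proper_subterm (Fn f ss) (Fn f ts))"
proof
  assume "\<exists>f ss ts. subterm (Fn f ts) t \<and> proper_subterm (Fn f ss) (Fn f ts)"
  then obtain f ss ts where "subterm (Fn f ts) t" "proper_subterm (Fn f ss) (Fn f ts)"
    by blast
  then show "cyclic 1 t"
    unfolding cyclic_def
    \<comment> \<open>For \<open>n = 1\<close> the definition reads the sequence at 1 and 2
      only.\<close>
    by (intro exI[of _ f] exI[of _ "\<lambda>i::nat. if i = 1 then ss else ts"]) simp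
qed (auto simp: cyclic_def)

definition sym_role :: rname where
  "sym_role = RName 0"

definition sym_tbox :: "axiom set" where
  "sym_tbox = {SubEx TopC sym_role TopC, SubInvRole sym_role sym_role}"

lemma horn_sriq_sym_tbox: "horn_sriq_tbox sym_tbox"
proof -
  \<comment> \<open>The empty order suffices: the only role inclusion has the form
    \<open>[Inv R]\<close>, which regularity always permits.\<close>
  have "regular sym_tbox"
    unfolding regular_def
    by (intro exI[of _ "\<lambda>_ _. False"])
      (auto simp: regular_role_order_def regular_inclusion_def sym_tbox_def irreflp_def transp_def)
  then show ?thesis
    by (auto simp: horn_sriq_tbox_def sym_tbox_def)
qed

lemma rules_of_sym_tbox: "rules_of sym_tbox =
   {ex_rule TopC sym_role TopC, TGD [rat sym_role VY VX] [rat sym_role VX VY],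
    TGD [cat TopC VX] [cat TopC VX], TGD [rat sym_role VX VY] [cat TopC VX, cat TopC VY]}"
  by (auto simp: rules_of_def sym_tbox_def top_rules_def preds_of_def ex_rule_def)

lemma univ_tgds_sym_tbox: "univ_tgds (rules_of sym_tbox) =
   {TGD [rat sym_role VY VX] [rat sym_role VX VY],
    TGD [cat TopC VX] [cat TopC VX], TGD [rat sym_role VX VY] [cat TopC VX, cat TopC VY]}"
  by (auto simp: univ_tgds_def tgds_def rules_of_sym_tbox ex_rule_def atoms_vars_def)

lemma egds_sym_tbox: "egds (rules_of sym_tbox) = {}"
  by (auto simp: egds_def rules_of_sym_tbox ex_rule_def)

lemma ex_rule_in_sym_tbox:
  "ex_rule A R B \<in> rules_of sym_tbox \<longleftrightarrow> A = TopC \<and> R = sym_role \<and> B = TopC"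
  by (auto simp: rules_of_sym_tbox ex_rule_def)

abbreviation star :: "var sterm" where
  "star \<equiv> Con Star"

abbreviation succ :: "var sterm \<Rightarrow> var sterm" where
  "succ \<equiv> ex_term TopC sym_role TopC"

lemma restricted_succ_succ_star: "restricted_term prec sym_tbox (succ (succ star))"
proof -
  define \<R> where "\<R> = univ_tgds (rules_of sym_tbox) \<union> egds (rules_of sym_tbox)"
  define I where "I = term_instance sym_tbox (succ star)"
  have I: "I = {cat TopC star, rat sym_role star (succ star), cat TopC (succ star)}"
    by (auto simp: I_def ex_term_def ex_rule_in_sym_tbox)
  have egds: "egds \<R> = {}"
    unfolding \<R>_def egds_sym_tbox univ_tgds_sym_tbox by (auto simp: egds_def)
  let ?\<rho> = "TGD [rat sym_role VY VX] [rat sym_role VX VY]"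
  have "?\<rho> \<in> univ_tgds \<R>"
    unfolding \<R>_def univ_tgds_sym_tbox by (simp add: univ_tgds_def tgds_def atoms_vars_def)
  note restricted_app_univ_subset_rchase[OF egds this, of I prec]
  \<comment> \<open>The body is \<open>R(y, x)\<close>, so \<open>x\<close> goes to
    \<open>succ star\<close> and \<open>y\<close> to \<open>star\<close>. The application is not
    blocked, since \<open>I\<close> lacks the resulting fact.\<close>
  moreover have "rat sym_role (succ star) star \<in> restricted_app ?\<rho> I"
    by (auto simp: I inst_def atoms_vars_def skolem_subst_def ex_term_def
        intro!: exI[of _ "\<lambda>v. if v = VY then star else succ star"])
  moreover have "cat TopC star \<in> rchase prec \<R> I"
    unfolding rchase_def by (rule UN_I[of 0]) (simp_all add: I)
  ultimately show ?thesis
    unfolding restricted_term_def Let_def \<R>_def[symmetric]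
    by (intro exI[of _ TopC] exI[of _ sym_role] exI[of _ "succ star"] exI[of _ star])
      (auto simp: ex_rule_in_sym_tbox I_def[symmetric] replaced_by_no_egds[OF egds])
qed

text \<open>An upper bound of \<open>expansion_set\<close> is enough for acyclicity. Whether
  \<open>succ star\<close> is restricted can stay open, as its facts are included either
  way.\<close>

definition sym_expansion :: "var fact set" where
  "sym_expansion =
     {cat TopC star, cat TopC (succ star), rat sym_role star star,
      rat sym_role star (succ star), rat sym_role (succ star) star}"

lemma expansion_closed_sym_expansion: "expansion_closed prec sym_tbox sym_expansion"
proof -
  have "\<forall>\<rho>\<in>univ_tgds (rules_of sym_tbox). restricted_app \<rho> sym_expansion \<subseteq> sym_expansion"
    by (auto simp: univ_tgds_sym_tbox sym_expansion_def inst_def skolem_subst_def atoms_vars_def)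
  \<comment> \<open>For \<open>t = star\<close> the required facts are present; for
    \<open>t = succ star\<close> the new term is restricted.\<close>
  moreover have "{rat R t (ex_term A R B t), cat B (ex_term A R B t)} \<subseteq> sym_expansion"
    if "ex_rule A R B \<in> rules_of sym_tbox" and "cat A t \<in> sym_expansion"
      and "\<not> restricted_term prec sym_tbox (ex_term A R B t)" for A R B t
    using that restricted_succ_succ_star[of prec]
    by (auto simp: ex_rule_in_sym_tbox sym_expansion_def)
  moreover have "EGD b x y \<notin> rules_of sym_tbox" for b x y
    using egds_sym_tbox by (auto simp: egds_def)
  moreover have "eqat t u \<notin> sym_expansion" for t u
    by (simp add: sym_expansion_def)
  ultimately show ?thesis
    unfolding expansion_closed_def by blast
qed

lemma RCA_sym_tbox: "RCA prec 1 sym_tbox"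
proof -
  have "critical_instance (tgds (rules_of sym_tbox)) \<subseteq> sym_expansion"
    by (auto simp: critical_instance_def tgds_def rules_of_sym_tbox ex_rule_def sym_expansion_def)
  then have "expansion_set prec sym_tbox \<subseteq> sym_expansion"
    using expansion_closed_sym_expansion[of prec] unfolding expansion_set_def by blast
  then have "terms_of (expansion_set prec sym_tbox) \<subseteq> terms_of sym_expansion"
    by (auto simp: terms_of_def)
  also have "\<dots> = {star, succ star}"
    by (auto simp: terms_of_def sym_expansion_def)
  finally have "terms_of (expansion_set prec sym_tbox) \<subseteq> {star, succ star}" .
  moreover have "\<not> cyclic 1 star" "\<not> cyclic 1 (succ star)"
    unfolding cyclic_1 proper_subterm_def ex_term_def by (auto simp: subterm_Fn subterm_Con)
  ultimately show ?thesis
    unfolding RCA_def by blast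
qed

text \<open>A single member of \<open>Sing\<close> already yields a cyclic term. Singularizing the
  existential rule only adds \<open>Eq(x, x)\<close> to its body, which the reflexivity rule derives
  from \<open>TopC\<close>; so the rule fires on each term it creates.\<close>

lemma not_MFA_union_sym_tbox: "\<not> MFA_union sym_tbox"
proof -
  let ?x = "(VX, 1::nat)" and ?y = "(VY, 0::nat)"
  let ?b = "[cat TopC ?x, eqat ?x ?x]" and ?h = "[rat sym_role ?x ?y, cat TopC ?y]"
  let ?C = "oblivious_chase (\<Union>(Sing (sigma_of sym_tbox)))"
  let ?f = "\<lambda>t. Fn (TGD ?b ?h, ?y) [t]"
  let ?eq = "TGD [cat TopC (VX, 0)] [eqat (VX, 0) (VX, 0)]"
  \<comment> \<open>Choosing the first occurrence of every variable is always admissible, because a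
    body variable occurs at least once.\<close>
  define g :: "var rule \<Rightarrow> (var \<times> nat) rule" where
    "g \<rho> = (case \<rho> of TGD b h \<Rightarrow> singularize (\<lambda>_. 1) b h)" for \<rho>
  have sing: "g \<rho> \<in> singularizations \<rho>" if sigma: "\<rho> \<in> sigma_of sym_tbox" for \<rho>
  proof -
    obtain b h where \<rho>: "\<rho> = TGD b h"
      using sigma unfolding sigma_of_def by (metis egd_to_tgd.elims imageE)
    have "0 < count_list (atoms_vars b) v" if "v \<in> set (atoms_vars b)" for v
      using that by (simp add: count_list_0_iff flip: neq0_conv)
    then have "\<forall>v\<in>set (atoms_vars b). 1 \<in> {1..count_list (atoms_vars b) v}"
      by (auto simp: Suc_le_eq)
    then show ?thesis
      unfolding \<rho> g_def by auto
  qed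
  have "g (ex_rule TopC sym_role TopC) = TGD ?b ?h"
    by (simp add: g_def ex_rule_def singularize_def atoms_vars_def)
  moreover have "ex_rule TopC sym_role TopC \<in> sigma_of sym_tbox"
    unfolding sigma_of_def rules_of_sym_tbox by (simp add: ex_rule_def)
  ultimately have "TGD ?b ?h \<in> g ` sigma_of sym_tbox"
    by (metis imageI)
  moreover have "?eq \<in> eq_rules"
    by (simp add: eq_rules_def Let_def)
  moreover have "eq_rules \<union> g ` sigma_of sym_tbox \<in> Sing (sigma_of sym_tbox)"
    unfolding Sing_def using sing by blast
  ultimately have ex: "TGD ?b ?h \<in> \<Union>(Sing (sigma_of sym_tbox))"
    and eq: "?eq \<in> \<Union>(Sing (sigma_of sym_tbox))"
    by blast+
  have top_eq: "eqat t t \<in> ?C" if "cat TopC t \<in> ?C" for t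
    by (rule oblivious_chase.intros(2)[OF eq, of "\<lambda>_. t"])
      (use that in \<open>auto simp: inst_def skolem_subst_def atoms_vars_def\<close>)
  have top_f: "cat TopC (?f t) \<in> ?C" if "cat TopC t \<in> ?C" for t
    by (rule oblivious_chase.intros(2)[OF ex, of "\<lambda>_. t"])
      (use that top_eq[OF that] in
        \<open>auto simp: inst_def skolem_subst_def atoms_vars_def frontier_def\<close>)
  have "cat TopC (Con Star) \<in> ?C"
    by (rule oblivious_chase.intros(1), unfold critical_instance_def, rule UN_I[OF ex]) simp
  then have "cat TopC (?f (?f (Con Star))) \<in> ?C"
    by (intro top_f)
  then have "?f (?f (Con Star)) \<in> terms_of ?C"
    unfolding terms_of_def by force
  moreover have "cyclic 1 (?f (?f (Con Star)))"
    \<comment> \<open>The nested pair is \<open>?f (Con Star)\<close> inside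
      \<open>?f (?f (Con Star))\<close>.\<close>
    unfolding cyclic_1 proper_subterm_def
    by (intro exI[of _ "(TGD ?b ?h, ?y)"] exI[of _ "[Con Star]"] exI[of _ "[?f (Con Star)]"])
      (simp add: subterm_Fn)
  ultimately show ?thesis
    unfolding MFA_union_def MFA_def by blast
qed

theorem theorem4:
  fixes prec :: "var sterm \<Rightarrow> var sterm \<Rightarrow> bool"
  assumes "term_order prec"
  shows "\<exists>T. horn_sriq_tbox T \<and> RCA prec 1 T \<and> \<not> MFA_union T"
  using horn_sriq_sym_tbox RCA_sym_tbox not_MFA_union_sym_tbox by blast

end
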